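(* Let $h=x^{a_1}y^{a_2}+y^{a_1}z^{a_2}+z^{a_1}x^{a_2}$, $a_1>a_2\ge0$, be a symmetric (regular) trinomial of degree $d=a_1+a_2\ge4$. If $l\ge1$ is an integer representing an element of $(\mathbb{Z}/2\lambda\mathbb{Z})^*$ and there is an integer $s\ge0$ such that $$\frac{3l^s}{4}\le\frac{\lambda}{\alpha}<\frac{3l^s}{2},\quad\text{then}\quad \Delta_{h,1}(l)=\left(3\left|\frac{l^s\alpha}{\lambda}-1\right|,\,s\right).$$ In the case $h=x^{d-1}y+y^{d-1}z+z^{d-1}x$ (for which $\alpha=d-2$, $\lambda=d^2-3d+3$ and $\lambda_h=\lambda$): (1) Suppose $d\ge4$ is even. Then (such an $m\ge2$ always exists) $$3\cdot2^{m-2}\le d-1<3\cdot2^{m-1}\ \Longrightarrow\ \Delta_{h,1}(\lambda\pm2)=\left(3\left|1-\frac{2^m\alpha}{\lambda}\right|,\,m\right).$$ (2) Suppose $d\ge3$ is odd. Then $d=3\Rightarrow\Delta_{h,1}(\lambda\pm2)=(1,\infty)$; $d=5\Rightarrow\Delta_{h,1}(\lambda\pm2)=\left(\frac{6}{\lambda},3\right)$; $d\ge7\Rightarrow\Delta_{h,1}(\lambda\pm2)=\left(\frac{6\alpha}{\lambda},1\right)$.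
   Context: For a symmetric trinomial $h=x^{a_1}y^{a_2}+y^{a_1}z^{a_2}+z^{a_1}x^{a_2}$ with $a_1>a_2\ge0$, of degree $d=a_1+a_2$ (assumed irreducible), $\alpha=a_1-a_2$, $\lambda=a_1^2+a_2^2-a_1a_2$, $\lambda_h=\lambda/\gcd(\alpha,\lambda)$, and $t=(\alpha/\lambda,\alpha/\lambda,\alpha/\lambda)$. Let $L_{odd}=\{u\in\mathbb{Z}^3:u_1+u_2+u_3\text{ odd}\}$ and, for $v\in\mathbb{R}^3$, $u\in L_{odd}$, $\mathrm{Td}(v,u)=\sum_i|v_i-u_i|$. For $n\ge1$ and an integer $l$ coprime to $2\lambda_h$, $\Delta_{h,n}(l)$ is defined as follows: if there are $s\ge0$ and $u\in L_{odd}$ with $\mathrm{Td}(l^stn,u)<1$, take the smallest such $s$ and (the unique) such $u$, and put $\Delta_{h,n}(l)=(\mathrm{Td}(l^stn,u),s)$; otherwise $\Delta_{h,n}(l)=(1,\infty)$. It depends only on the class of $l$ in $(\mathbb{Z}/2\lambda_h\mathbb{Z})^*/\{\pm1\}$. *)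

theory Defs
  imports
    "HOL-Analysis.Analysis"
    "HOL-Library.Extended_Nat"
    "HOL-Library.Poly_Mapping"
    "HOL-Computational_Algebra.Factorial_Ring"
begin

text \<open>
  \<open>k[x,y,z]\<close> as finitely supported functions from exponent vectors to \<open>k\<close>, the product being
  convolution.  The three variables are indexed by the elements \<open>1\<close>, \<open>2\<close>, \<open>3\<close> of the
  three-element type \<open>3\<close>, as for the coordinates of \<open>real ^ 3\<close> (so \<open>3 = 0\<close> there).
\<close>

type_synonym 'k poly3 = "(3 \<Rightarrow>\<^sub>0 nat) \<Rightarrow>\<^sub>0 'k"

definition monomial3 :: "nat \<Rightarrow> nat \<Rightarrow> nat \<Rightarrow> 'k::field poly3" where
  "monomial3 i j k =
     Poly_Mapping.single
       (Poly_Mapping.single 1 i + Poly_Mapping.single 2 j + Poly_Mapping.single 3 k) 1"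

definition sym_trinomial :: "nat \<Rightarrow> nat \<Rightarrow> 'k::field poly3" where
  "sym_trinomial a1 a2 = monomial3 a1 a2 0 + monomial3 0 a1 a2 + monomial3 a2 0 a1"

text \<open>
  The invariants below depend on \<open>h = sym_trinomial a1 a2\<close> only through its exponents, which are
  therefore their arguments.
\<close>

definition tri_alpha :: "nat \<Rightarrow> nat \<Rightarrow> int" where
  "tri_alpha a1 a2 = int a1 - int a2"

definition tri_lambda :: "nat \<Rightarrow> nat \<Rightarrow> int" where
  "tri_lambda a1 a2 = (int a1)\<^sup>2 + (int a2)\<^sup>2 - int a1 * int a2"

definition tri_lambda_h :: "nat \<Rightarrow> nat \<Rightarrow> int" where
  "tri_lambda_h a1 a2 = tri_lambda a1 a2 div gcd (tri_alpha a1 a2) (tri_lambda a1 a2)"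

definition tri_t :: "nat \<Rightarrow> nat \<Rightarrow> real ^ 3" where
  "tri_t a1 a2 = (\<chi> i. real_of_int (tri_alpha a1 a2) / real_of_int (tri_lambda a1 a2))"

definition L_odd :: "(int ^ 3) set" where
  "L_odd = {u. odd (u $ 1 + u $ 2 + u $ 3)}"

definition Td :: "real ^ 3 \<Rightarrow> int ^ 3 \<Rightarrow> real" where
  "Td v u = (\<Sum>i\<in>UNIV. \<bar>v $ i - real_of_int (u $ i)\<bar>)"

text \<open>
  The description operator in \<open>Delta\<close> below is justified by the next lemma: two distinct points
  of \<open>L_odd\<close> are at taxicab distance at least 2.
\<close>

lemma L_odd_near_unique:
  assumes "u \<in> L_odd" "w \<in> L_odd" "Td v u < 1" "Td v w < 1"
  shows "u = w"
proof -
  define a b c where "a = u $ 1 - w $ 1" and "b = u $ 2 - w $ 2" and "c = u $ 3 - w $ 3"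
  have "real_of_int (\<bar>a\<bar> + \<bar>b\<bar> + \<bar>c\<bar>) < 2"
    using assms(3,4) unfolding Td_def sum_3 a_def b_def c_def of_int_add of_int_abs of_int_diff
    by linarith
  hence "\<bar>a\<bar> + \<bar>b\<bar> + \<bar>c\<bar> < 2" by linarith
  moreover have "even (a + b + c)"
    using assms(1,2) unfolding L_odd_def a_def b_def c_def mem_Collect_eq by presburger
  ultimately have "a = 0 \<and> b = 0 \<and> c = 0" by presburger
  thus ?thesis by (simp add: vec_eq_iff forall_3 a_def b_def c_def)
qed

text \<open>
  \<open>Delta a1 a2 n l\<close> is \<open>\<Delta>\<^bsub>h,n\<^esub>(l)\<close>; it is meaningful for \<open>n \<ge> 1\<close> and for \<open>l\<close> coprime to
  \<open>2 * tri_lambda_h a1 a2\<close>.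
\<close>

definition scaled_t :: "nat \<Rightarrow> nat \<Rightarrow> nat \<Rightarrow> int \<Rightarrow> nat \<Rightarrow> real ^ 3" where
  "scaled_t a1 a2 n l s = (real_of_int l ^ s * real n) *\<^sub>R tri_t a1 a2"

definition Delta :: "nat \<Rightarrow> nat \<Rightarrow> nat \<Rightarrow> int \<Rightarrow> real \<times> enat" where
  "Delta a1 a2 n l =
     (if \<exists>s. \<exists>u\<in>L_odd. Td (scaled_t a1 a2 n l s) u < 1
      then let s = (LEAST s. \<exists>u\<in>L_odd. Td (scaled_t a1 a2 n l s) u < 1);
               u = (THE u. u \<in> L_odd \<and> Td (scaled_t a1 a2 n l s) u < 1)
           in (Td (scaled_t a1 a2 n l s) u, enat s)
      else (1, \<infinity>))"

text \<open>The values of \<open>l\<close> used for \<open>x\<^sup>d\<^sup>-\<^sup>1y + y\<^sup>d\<^sup>-\<^sup>1z + z\<^sup>d\<^sup>-\<^sup>1x\<close> are admissible:\<close>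

lemma coprime_lambda_pm_2:
  assumes "l \<in> {tri_lambda (d - 1) 1 + 2, tri_lambda (d - 1) 1 - 2}"
  shows "coprime l (2 * tri_lambda (d - 1) 1)"
proof -
  let ?L = "tri_lambda (d - 1) 1"
  have "odd ?L" by (simp add: tri_lambda_def power2_eq_square)
  hence "coprime l 2" and "coprime 2 ?L" using assms by auto
  moreover have "gcd l ?L = gcd 2 ?L"
    using assms gcd_add1[of 2 ?L] gcd_diff2[of ?L 2] by (auto simp: add.commute gcd.commute)
  ultimately show ?thesis
    unfolding coprime_mult_right_iff by (metis coprime_iff_gcd_eq_1)
qed

end

theory Submission
  imports Defs
begin

text \<open>
  The multiples of \<open>t\<close> have three equal coordinates \<open>x\<close>, and a diagonal point is at taxicab distance
  less than 1 from \<open>L_odd\<close> exactly when \<open>x\<close> is at distance less than \<open>1/3\<close> from some odd integer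
  \<open>c\<close>, the nearby point being \<open>(c, c, c)\<close>.  So one looks for the first power with
  \<open>l\<^sup>s \<alpha> / \<lambda>\<close> close to an odd integer.  As long as \<open>0 < l\<^sup>s \<alpha> / \<lambda> \<le> 2/3\<close> none is close, and
  the bounds on \<open>\<lambda> / \<alpha>\<close> place the first larger value in \<open>(2/3, 4/3)\<close>.  For \<open>a\<^sub>2 = 1\<close> and \<open>d\<close> even,
  \<open>\<alpha>\<close> is even, so \<open>(\<lambda> \<plusminus> 2)\<^sup>s \<alpha> / \<lambda>\<close> agrees with \<open>(\<plusminus>2)\<^sup>s \<alpha> / \<lambda>\<close> modulo 2; for \<open>d\<close> odd,
  \<open>(\<lambda> \<plusminus> 2) \<alpha> / \<lambda>\<close> is at distance \<open>2 \<alpha> / \<lambda>\<close> from the odd integer \<open>\<alpha>\<close>.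
\<close>

section \<open>Diagonal points and reduction to a single real coordinate\<close>

lemma Td_diagonal: "Td (\<chi> i. x) (\<chi> i. c) = 3 * \<bar>x - of_int c\<bar>"
  by (simp add: Td_def)

lemma diagonal_in_L_odd: "(\<chi> i. c) \<in> L_odd \<longleftrightarrow> odd c"
  by (simp add: L_odd_def)

text \<open>By the triangle inequality through \<open>x\<close>, the pairwise differences of the
  coordinates of \<open>u\<close> sum to less than 2. For integers that sum is twice the range, so
  it vanishes.\<close>

lemma near_diagonal_imp_diagonal:
  assumes u: "u \<in> L_odd" and near: "Td (\<chi> i. x) u < 1"
  obtains c where "odd c" "u = (\<chi> i. c)" "3 * \<bar>x - of_int c\<bar> < 1"
proof -
  define a b c where abc: "a = u $ 1" "b = u $ 2" "c = u $ 3"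
  have td: "\<bar>x - of_int a\<bar> + \<bar>x - of_int b\<bar> + \<bar>x - of_int c\<bar> < 1"
    using near by (simp add: Td_def sum_3 abc)
  have od: "odd (a + b + c)" using u by (simp add: L_odd_def abc)
  have "real_of_int (\<bar>a - b\<bar> + \<bar>b - c\<bar> + \<bar>a - c\<bar>) < 2"
    unfolding of_int_add of_int_abs of_int_diff using td by linarith
  hence "\<bar>a - b\<bar> + \<bar>b - c\<bar> + \<bar>a - c\<bar> < 2" by linarith
  hence eq: "a = c" "b = c" by presburger+
  have diag: "u = (\<chi> i. c)"
    using eq by (simp add: vec_eq_iff forall_3 abc)
  show thesis
    by (rule that[of c]) (use od eq diag td in auto)
qed

definition near_odd :: "real \<Rightarrow> bool" where
  "near_odd x \<longleftrightarrow> (\<exists>c::int. odd c \<and> \<bar>x - of_int c\<bar> < 1 / 3)"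

lemma not_near_odd_small:
  assumes "0 \<le> x" "x \<le> 2 / 3"
  shows "\<not> near_odd x"
proof
  assume "near_odd x"
  then obtain c :: int where c: "odd c" "\<bar>x - of_int c\<bar> < 1 / 3"
    by (auto simp: near_odd_def)
  have "real_of_int c < 1" using c(2) assms by linarith
  moreover have "real_of_int c > -1" using c(2) assms by linarith
  ultimately have "c = 0" by linarith
  thus False using c(1) by simp
qed

text \<open>Sign changes and even translations permute the odd integers. Signs and multiples of 2
  can therefore be discarded before estimating.\<close>

lemma near_odd_reflect_shift:
  assumes "\<sigma> \<in> {1, -1 :: int}"
  shows "near_odd (of_int \<sigma> * y + 2 * of_int k) \<longleftrightarrow> near_odd y"
proof
  assume "near_odd (of_int \<sigma> * y + 2 * of_int k)"
  then obtain c :: int where c: "odd c" "\<bar>of_int \<sigma> * y + 2 * of_int k - of_int c\<bar> < 1 / 3"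
    by (auto simp: near_odd_def)
  have "\<bar>y - of_int (\<sigma> * (c - 2 * k))\<bar> = \<bar>of_int \<sigma> * y + 2 * of_int k - of_int c\<bar>"
    using assms by auto
  moreover have "odd (\<sigma> * (c - 2 * k))" using assms c(1) by auto
  ultimately show "near_odd y" unfolding near_odd_def using c(2) by metis
next
  assume "near_odd y"
  then obtain c :: int where c: "odd c" "\<bar>y - of_int c\<bar> < 1 / 3"
    by (auto simp: near_odd_def)
  have "\<bar>of_int \<sigma> * y + 2 * of_int k - of_int (\<sigma> * c + 2 * k)\<bar> = \<bar>y - of_int c\<bar>"
    using assms by auto
  moreover have "odd (\<sigma> * c + 2 * k)" using assms c(1) by auto
  ultimately show "near_odd (of_int \<sigma> * y + 2 * of_int k)"
    unfolding near_odd_def using c(2) by metis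
qed

definition multiple_t :: "nat \<Rightarrow> nat \<Rightarrow> int \<Rightarrow> nat \<Rightarrow> real" where
  "multiple_t a1 a2 l s =
     real_of_int l ^ s * real_of_int (tri_alpha a1 a2) / real_of_int (tri_lambda a1 a2)"

lemma scaled_t_1: "scaled_t a1 a2 1 l s = (\<chi> i. multiple_t a1 a2 l s)"
  by (simp add: scaled_t_def tri_t_def multiple_t_def vec_eq_iff)

lemma near_L_odd_iff:
  "(\<exists>u\<in>L_odd. Td (scaled_t a1 a2 1 l s) u < 1) \<longleftrightarrow> near_odd (multiple_t a1 a2 l s)"
proof
  assume "\<exists>u\<in>L_odd. Td (scaled_t a1 a2 1 l s) u < 1"
  then obtain u where "u \<in> L_odd" "Td (\<chi> i. multiple_t a1 a2 l s) u < 1"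
    unfolding scaled_t_1 by blast
  then obtain c where "odd c" "3 * \<bar>multiple_t a1 a2 l s - of_int c\<bar> < 1"
    by (rule near_diagonal_imp_diagonal)
  thus "near_odd (multiple_t a1 a2 l s)" unfolding near_odd_def by (intro exI[of _ c]) simp
next
  assume "near_odd (multiple_t a1 a2 l s)"
  then obtain c :: int where "odd c" "\<bar>multiple_t a1 a2 l s - of_int c\<bar> < 1 / 3"
    by (auto simp: near_odd_def)
  hence "(\<chi> i. c) \<in> L_odd" "Td (scaled_t a1 a2 1 l s) (\<chi> i. c) < 1"
    unfolding scaled_t_1 Td_diagonal diagonal_in_L_odd by simp_all
  thus "\<exists>u\<in>L_odd. Td (scaled_t a1 a2 1 l s) u < 1" by blast
qed

text \<open>Certificate for a finite value: \<open>c\<close> supplies the point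
  \<open>(c, c, c)\<close>, which \<open>L_odd_near_unique\<close> identifies with the one described
  in \<open>Delta\<close>, and \<open>least\<close> fixes the exponent.\<close>

lemma Delta_eqI:
  assumes c: "odd c" and near: "\<bar>multiple_t a1 a2 l s - of_int c\<bar> < 1 / 3"
    and least: "\<And>r. r < s \<Longrightarrow> \<not> near_odd (multiple_t a1 a2 l r)"
  shows "Delta a1 a2 1 l = (3 * \<bar>multiple_t a1 a2 l s - of_int c\<bar>, enat s)"
proof -
  have ns: "near_odd (multiple_t a1 a2 l s)"
    unfolding near_odd_def using c near by blast
  have L: "(LEAST r. near_odd (multiple_t a1 a2 l r)) = s"
    using ns least by (intro Least_equality) (auto simp: not_less[symmetric])
  have cn: "(\<chi> i. c) \<in> L_odd \<and> Td (scaled_t a1 a2 1 l s) (\<chi> i. c) < 1"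
    unfolding scaled_t_1 Td_diagonal diagonal_in_L_odd using c near by simp
  have T: "(THE u. u \<in> L_odd \<and> Td (scaled_t a1 a2 1 l s) u < 1) = (\<chi> i. c)"
    using cn L_odd_near_unique by (intro the_equality) blast+
  have "\<exists>r. near_odd (multiple_t a1 a2 l r)" using ns by blast
  thus ?thesis
    unfolding Delta_def near_L_odd_iff L Let_def T by (simp only: scaled_t_1 Td_diagonal if_True)
qed

lemma Delta_eq_infinity:
  assumes "\<And>s. \<not> near_odd (multiple_t a1 a2 l s)"
  shows "Delta a1 a2 1 l = (1, \<infinity>)"
  unfolding Delta_def near_L_odd_iff using assms by simp

text \<open>Makes \<alpha>^2 \<le> \<lambda> visible.\<close>

lemma tri_lambda_eq: "tri_lambda a1 a2 = (tri_alpha a1 a2)\<^sup>2 + int a1 * int a2"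
  by (simp add: tri_lambda_def tri_alpha_def power2_eq_square algebra_simps)

section \<open>General symmetric trinomials\<close>

lemma Delta_between:
  assumes a: "a2 < a1" "a1 + a2 \<ge> 4"
    and l: "l \<ge> 1" "coprime l (2 * tri_lambda a1 a2)"
    and lo: "3 * real_of_int l ^ s / 4
          \<le> real_of_int (tri_lambda a1 a2) / real_of_int (tri_alpha a1 a2)"
    and hi: "real_of_int (tri_lambda a1 a2) / real_of_int (tri_alpha a1 a2)
          < 3 * real_of_int l ^ s / 2"
  shows "Delta a1 a2 1 l = (3 * \<bar>multiple_t a1 a2 l s - 1\<bar>, enat s)"
proof -
  define A L where AL: "A = tri_alpha a1 a2" "L = tri_lambda a1 a2"
  have A: "A \<ge> 1" using a by (simp add: AL tri_alpha_def)
  have L_eq: "L = A\<^sup>2 + int a1 * int a2" unfolding AL by (rule tri_lambda_eq)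
  have AA: "A * A \<le> L" using L_eq by (simp add: power2_eq_square)
  have L: "L > 0" using A AA mult_pos_pos[of A A] by linarith
  \<comment> \<open>This bound excludes \<open>l = 1\<close> and later \<open>l ^ s = 1\<close>.
    Only \<alpha> = 1 needs the term \<open>a1 * a2\<close>, which is positive because the degree is
    at least 4.\<close>
  have big: "2 * A \<le> L"
  proof (cases "A = 1")
    case True
    have "int a1 * int a2 \<ge> 1 * 1"
      using a True by (intro mult_mono) (auto simp: AL tri_alpha_def)
    thus ?thesis using L_eq True by simp
  next
    case False
    hence "2 * A \<le> A * A" using A by (intro mult_right_mono) auto
    thus ?thesis using AA by linarith
  qed
  have lo': "3 * l ^ s * A \<le> 4 * L"
  proof -
    have "3 * real_of_int l ^ s * real_of_int A \<le> 4 * real_of_int L"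
      using lo A by (simp add: AL[symmetric] field_simps)
    thus ?thesis by (metis (mono_tags) of_int_le_iff of_int_mult of_int_numeral of_int_power)
  qed
  have hi': "2 * L < 3 * l ^ s * A"
  proof -
    have "2 * real_of_int L < 3 * real_of_int l ^ s * real_of_int A"
      using hi A by (simp add: AL[symmetric] field_simps)
    thus ?thesis by (metis (mono_tags) of_int_less_iff of_int_mult of_int_numeral of_int_power)
  qed
  have odd_l: "odd l" and cop: "coprime l L"
    using l(2) by (auto simp: AL)
  have "l \<noteq> 1"
  proof
    assume "l = 1"
    hence "2 * L < 3 * A" using hi' by simp
    thus False using big A by linarith
  qed
  hence l3: "l \<ge> 3" using l(1) odd_l by (cases "l = 2") auto
  \<comment> \<open>Equality would put \<open>l\<^sup>s \<alpha> / \<lambda>\<close> at distance exactly \<open>1/3\<close> from 1; coprimality excludes it.\<close>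
  have lo'': "3 * l ^ s * A < 4 * L"
  proof (rule ccontr)
    assume "\<not> 3 * l ^ s * A < 4 * L"
    hence eq: "3 * l ^ s * A = 4 * L" using lo' by simp
    have "coprime l (2 * 2 * L)"
      using odd_l cop by (intro coprime_mult_right_iff[THEN iffD2] conjI) simp_all
    hence "coprime (l ^ s) (4 * L)" by simp
    moreover have "l ^ s dvd 4 * L" unfolding eq[symmetric] by simp
    ultimately have "is_unit (l ^ s)" using coprime_absorb_left by blast
    hence "l ^ s = 1" using l(1) by simp
    thus False using eq big A by auto
  qed
  have near: "2 / 3 < multiple_t a1 a2 l s" "multiple_t a1 a2 l s < 4 / 3"
  proof -
    have "2 * real_of_int L < 3 * real_of_int l ^ s * real_of_int A"
      using hi' by (metis (mono_tags) of_int_less_iff of_int_mult of_int_numeral of_int_power)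
    moreover have "3 * real_of_int l ^ s * real_of_int A < 4 * real_of_int L"
      using lo'' by (metis (mono_tags) of_int_less_iff of_int_mult of_int_numeral of_int_power)
    ultimately show "2 / 3 < multiple_t a1 a2 l s" "multiple_t a1 a2 l s < 4 / 3"
      unfolding multiple_t_def AL[symmetric] using L by (simp_all add: field_simps)
  qed
  \<comment> \<open>Since \<open>l\<close> is at least 3, every earlier term is at most a third of
    the term at \<open>s\<close>, hence below 4/9.\<close>
  have "\<not> near_odd (multiple_t a1 a2 l r)" if "r < s" for r
  proof (rule not_near_odd_small)
    show "0 \<le> multiple_t a1 a2 l r"
      unfolding multiple_t_def AL[symmetric] using A L l3 by simp
    have "real_of_int l ^ r * 3 \<le> real_of_int l ^ r * real_of_int l"
      using l3 by (intro mult_left_mono) auto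
    also have "\<dots> = real_of_int l ^ Suc r" by simp
    also have "\<dots> \<le> real_of_int l ^ s" using that l3 by (intro power_increasing) auto
    finally have "real_of_int l ^ r * 3 * A / L \<le> real_of_int l ^ s * A / L"
      using A L by (intro divide_right_mono mult_right_mono) auto
    hence "3 * multiple_t a1 a2 l r \<le> multiple_t a1 a2 l s"
      unfolding multiple_t_def AL[symmetric] by (simp add: mult_ac)
    thus "multiple_t a1 a2 l r \<le> 2 / 3" using near by linarith
  qed
  moreover have "\<bar>multiple_t a1 a2 l s - of_int 1\<bar> < 1 / 3"
    unfolding of_int_1 using near by linarith
  ultimately show ?thesis using Delta_eqI[of 1] by simp
qed

section \<open>Invariants of the family with \<open>a2 = 1\<close>\<close>

lemma tri_alpha_d:
  assumes "d \<ge> 1" shows "tri_alpha (d - 1) 1 = int d - 2"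
  using assms by (simp add: tri_alpha_def of_nat_diff)

lemma tri_lambda_d:
  assumes "d \<ge> 1" shows "tri_lambda (d - 1) 1 = (int d)\<^sup>2 - 3 * int d + 3"
  using assms by (simp add: tri_lambda_def of_nat_diff power2_eq_square algebra_simps)

text \<open>The shape \<alpha> (\<alpha> + 1) + 1 shows that \<lambda> is 1 modulo \<alpha>, and it
  serves the size estimates in general degree.\<close>

lemma tri_lambda_d_factor:
  assumes "d \<ge> 1" shows "tri_lambda (d - 1) 1 = (int d - 2) * (int d - 1) + 1"
  unfolding tri_lambda_d[OF assms] by (simp add: power2_eq_square algebra_simps)

lemma tri_lambda_h_d:
  assumes "d \<ge> 1" shows "tri_lambda_h (d - 1) 1 = tri_lambda (d - 1) 1"
proof -
  have "coprime (int d - 2) ((int d - 2) * (int d - 1) + 1)"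
    by (metis coprime_1_right coprime_iff_gcd_eq_1 gcd_add_mult mult.commute add.commute)
  hence "gcd (tri_alpha (d - 1) 1) (tri_lambda (d - 1) 1) = 1"
    unfolding tri_alpha_d[OF assms] tri_lambda_d_factor[OF assms] by simp
  thus ?thesis by (simp add: tri_lambda_h_def)
qed

lemma first_term_not_near_odd:
  assumes "d \<ge> 3"
  shows "\<not> near_odd (multiple_t (d - 1) 1 l 0)"
proof (rule not_near_odd_small)
  have d: "d \<ge> 1" using assms by simp
  have "(int d - 2) * 2 \<le> (int d - 2) * (int d - 1)"
    using assms by (intro mult_left_mono) auto
  hence "2 * tri_alpha (d - 1) 1 < tri_lambda (d - 1) 1" "tri_alpha (d - 1) 1 \<ge> 0"
    unfolding tri_alpha_d[OF d] tri_lambda_d_factor[OF d] using assms by auto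
  thus "0 \<le> multiple_t (d - 1) 1 l 0" "multiple_t (d - 1) 1 l 0 \<le> 2 / 3"
    by (auto simp: multiple_t_def field_simps)
qed

section \<open>The family in even degree\<close>

text \<open>From \<open>l\<close> congruent to 2 or -2 modulo \<open>L\<close> one gets the same for
  powers. The factor 2 in \<open>A\<close> lifts the congruence to the modulus \<open>2 * L\<close>,
  so that dividing by \<open>L\<close> leaves an even integer.\<close>

lemma power_mod_even_multiple:
  fixes A L l :: int
  assumes "even A" and l: "l \<in> {L + 2, L - 2}"
  obtains \<sigma> k :: int where "\<sigma> \<in> {1, -1}" "l ^ s * A = \<sigma> * 2 ^ s * A + 2 * L * k"
proof -
  obtain \<epsilon> :: int where e: "\<epsilon> \<in> {1, -1}" "l = L + \<epsilon> * 2" using l by fastforce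
  have "L dvd l ^ s - (\<epsilon> * 2) ^ s"
  proof -
    have "l - \<epsilon> * 2 dvd l ^ s - (\<epsilon> * 2) ^ s"
      by (metis dvd_triv_left power_diff_sumr2)
    thus ?thesis by (simp add: e(2))
  qed
  then obtain k where k: "l ^ s - (\<epsilon> * 2) ^ s = L * k" by (elim dvdE)
  obtain B where B: "A = 2 * B" using assms(1) by (elim evenE)
  show thesis
  proof (rule that)
    show "\<epsilon> ^ s \<in> {1, -1}" using e(1) by (cases "even s") auto
    have "l ^ s = \<epsilon> ^ s * 2 ^ s + L * k" using k by (simp add: power_mult_distrib)
    thus "l ^ s * A = \<epsilon> ^ s * 2 ^ s * A + 2 * L * (k * B)" by (simp add: B algebra_simps)
  qed
qed

text \<open>Up to sign and even shifts the sequence is \<open>y s\<close>, which doubles at each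
  step. The bounds on \<open>d - 1\<close> put \<open>y m\<close> between 2/3 and 4/3, so all
  earlier terms are below 2/3.\<close>

lemma Delta_even:
  assumes d: "d \<ge> 4" "even d"
    and m: "m \<ge> 2" "3 * 2 ^ (m - 2) \<le> d - 1" "d - 1 < 3 * 2 ^ (m - 1)"
    and l: "l \<in> {tri_lambda (d - 1) 1 + 2, tri_lambda (d - 1) 1 - 2}"
  shows "Delta (d - 1) 1 1 l = (3 * \<bar>1 - 2 ^ m * real_of_int (tri_alpha (d - 1) 1)
            / real_of_int (tri_lambda (d - 1) 1)\<bar>, enat m)"
proof -
  define A L where AL: "A = tri_alpha (d - 1) 1" "L = tri_lambda (d - 1) 1"
  define y where "y s = 2 ^ s * real_of_int A / real_of_int L" for s :: nat
  have d1: "d \<ge> 1" using d by simp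
  have A: "A = int d - 2" "A \<ge> 2" "even A" using d by (auto simp: AL(1)[unfolded tri_alpha_d[OF d1]])
  have L_eq: "L = A * (A + 1) + 1"
    unfolding AL tri_lambda_d_factor[OF d1] tri_alpha_d[OF d1] by simp
  have L: "L > 0" using A(2) by (simp add: L_eq add_pos_pos)
  have mult: "\<exists>\<sigma> k :: int. \<sigma> \<in> {1, -1} \<and>
      multiple_t (d - 1) 1 l s = of_int \<sigma> * y s + 2 * of_int k" for s
  proof -
    obtain \<sigma> k where sk: "\<sigma> \<in> {1, -1}" "l ^ s * A = \<sigma> * 2 ^ s * A + 2 * L * k"
      using power_mod_even_multiple[OF A(3) l[folded AL]] by metis
    have "real_of_int (l ^ s * A) = real_of_int (\<sigma> * 2 ^ s * A + 2 * L * k)"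
      using sk(2) by simp
    hence "multiple_t (d - 1) 1 l s = of_int \<sigma> * y s + 2 * of_int k"
      unfolding multiple_t_def y_def AL[symmetric] using L by (simp add: field_simps)
    thus ?thesis using sk(1) by blast
  qed
  obtain j where j: "m = j + 2" using m(1) by (metis add.commute le_Suc_ex)
  have b: "3 * 2 ^ j \<le> A + 1" "A + 1 < 6 * 2 ^ j"
  proof -
    have "int (3 * 2 ^ j) \<le> int (d - 1)" "int (d - 1) < int (3 * 2 ^ Suc j)"
      using m(2,3) unfolding j by (simp_all only: of_nat_le_iff of_nat_less_iff) simp_all
    thus "3 * 2 ^ j \<le> A + 1" "A + 1 < 6 * 2 ^ j"
      using d1 by (simp_all add: A(1) of_nat_diff)
  qed
  have up: "3 * 2 ^ m * A < 4 * L"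
    using mult_right_mono[OF b(1), of A] A(2) by (simp add: j L_eq algebra_simps)
  \<comment> \<open>Integrality sharpens \<open>b(2)\<close> to
    \<open>A + 2 \<le> 6 * 2 ^ j\<close>, just enough because \<lambda> = \<alpha>^2 + \<alpha> + 1
    stays below \<alpha> (\<alpha> + 2).\<close>
  have low: "2 * L < 3 * 2 ^ m * A"
  proof -
    have "(A + 2) * A \<le> 6 * 2 ^ j * A" using b(2) A(2) by (intro mult_right_mono) auto
    moreover have "L < (A + 2) * A" using A(2) by (simp add: L_eq algebra_simps)
    ultimately show ?thesis by (simp add: j algebra_simps)
  qed
  have near: "2 / 3 < y m" "y m < 4 / 3"
  proof -
    have "real_of_int (3 * 2 ^ m * A) < real_of_int (4 * L)"
      "real_of_int (2 * L) < real_of_int (3 * 2 ^ m * A)"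
      using up low by (simp_all only: of_int_less_iff)
    thus "2 / 3 < y m" "y m < 4 / 3" unfolding y_def using L by (simp_all add: field_simps)
  qed
  have least: "\<not> near_odd (multiple_t (d - 1) 1 l r)" if "r < m" for r
  proof -
    have "2 * y r = y (Suc r)" by (simp add: y_def)
    also have "\<dots> \<le> y m"
      unfolding y_def using that A(2) L
      by (intro divide_right_mono mult_right_mono power_increasing) auto
    finally have "y r \<le> 2 / 3" using near by linarith
    moreover have "0 \<le> y r" unfolding y_def using A(2) L by simp
    ultimately have "\<not> near_odd (y r)" by (intro not_near_odd_small)
    thus ?thesis using mult[of r] near_odd_reflect_shift by metis
  qed
  obtain \<sigma> k :: int where sk: "\<sigma> \<in> {1, -1}"
      "multiple_t (d - 1) 1 l m = of_int \<sigma> * y m + 2 * of_int k"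
    using mult by blast
  \<comment> \<open>The odd integer \<open>\<sigma> + 2 * k\<close> is the image of 1 under the
    reflection and shift that carry \<open>y m\<close> to the actual value.\<close>
  have dist: "\<bar>multiple_t (d - 1) 1 l m - of_int (\<sigma> + 2 * k)\<bar> = \<bar>1 - y m\<bar>"
    using sk by auto
  have "Delta (d - 1) 1 1 l = (3 * \<bar>multiple_t (d - 1) 1 l m - of_int (\<sigma> + 2 * k)\<bar>, enat m)"
  proof (rule Delta_eqI)
    show "odd (\<sigma> + 2 * k)" using sk(1) by auto
    show "\<bar>multiple_t (d - 1) 1 l m - of_int (\<sigma> + 2 * k)\<bar> < 1 / 3"
      unfolding dist using near by linarith
  qed (rule least)
  thus ?thesis unfolding dist by (simp add: y_def AL)
qed

text \<open>Choose \<open>2 ^ j\<close> as the largest power of 2 not exceeding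
  \<open>n div 3\<close>, and \<open>m = j + 2\<close>.\<close>

lemma binary_scale_exists:
  fixes n :: nat
  assumes "n \<ge> 3"
  shows "\<exists>m\<ge>2. 3 * 2 ^ (m - 2) \<le> n \<and> n < 3 * 2 ^ (m - 1)"
proof -
  obtain j where j: "2 ^ j \<le> n div 3" "n div 3 < 2 ^ (j + 1)"
    using ex_power_ivl1[of 2 "n div 3"] assms by (auto simp: Suc_le_eq div_greater_zero_iff)
  thus ?thesis by (intro exI[of _ "j + 2"]) auto
qed

section \<open>The family in odd degree\<close>

text \<open>Here \<lambda> = 3 and \<alpha> = 1, so distance below 1/3 from an integer forces
  \<open>l ^ s\<close> to be a multiple of 3, whereas \<open>l\<close> is 5 or 1.\<close>

lemma Delta_3:
  assumes l: "l \<in> {tri_lambda 2 1 + 2, tri_lambda 2 1 - 2}"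
  shows "Delta 2 1 1 l = (1, \<infinity>)"
proof (rule Delta_eq_infinity)
  fix s
  have L: "tri_lambda 2 1 = 3" and A: "tri_alpha 2 1 = 1"
    by (simp_all add: tri_lambda_def tri_alpha_def)
  have l: "l = 5 \<or> l = 1" using l unfolding L by simp
  show "\<not> near_odd (multiple_t 2 1 l s)"
  proof
    assume "near_odd (multiple_t 2 1 l s)"
    then obtain c :: int where c: "odd c" "\<bar>real_of_int l ^ s / 3 - of_int c\<bar> < 1 / 3"
      unfolding near_odd_def multiple_t_def L A by auto
    hence "\<bar>real_of_int l ^ s - 3 * of_int c\<bar> < 1" by (simp only: abs_less_iff) linarith
    hence "\<bar>real_of_int (l ^ s - 3 * c)\<bar> < 1" by simp
    hence "l ^ s = 3 * c" by linarith
    hence "3 dvd l ^ s" by simp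
    moreover have "prime (3 :: int)" by simp
    ultimately have "3 dvd l" using prime_dvd_power by blast
    thus False using l by auto
  qed
qed

text \<open>A point within 2/3 of an even integer is at least 1/3 away from all odd ones. The
  integer form lets concrete fractions be checked by arithmetic.\<close>

lemma not_near_odd_divideI:
  fixes p q c :: int
  assumes "q > 0" "even c" "3 * \<bar>p - c * q\<bar> \<le> 2 * q"
  shows "\<not> near_odd (of_int p / of_int q)"
proof -
  obtain k where k: "c = 2 * k" using assms(2) by (elim evenE)
  define \<sigma> :: int where "\<sigma> = (if p \<ge> c * q then 1 else -1)"
  define y where "y = real_of_int \<bar>p - c * q\<bar> / of_int q"
  have "real_of_int (3 * \<bar>p - c * q\<bar>) \<le> real_of_int (2 * q)"
    using assms(3) by (simp only: of_int_le_iff)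
  hence "\<not> near_odd y"
    unfolding y_def using assms(1) by (intro not_near_odd_small) (simp_all add: field_simps)
  moreover have "real_of_int p / of_int q = of_int \<sigma> * y + 2 * of_int k"
  proof -
    have "p = \<sigma> * \<bar>p - c * q\<bar> + 2 * k * q" by (simp add: \<sigma>_def k)
    hence "real_of_int p = of_int (\<sigma> * \<bar>p - c * q\<bar> + 2 * k * q)" by presburger
    thus ?thesis unfolding y_def using assms(1) by (simp add: field_simps)
  qed
  moreover have "\<sigma> \<in> {1, -1}" by (simp add: \<sigma>_def)
  ultimately show ?thesis using near_odd_reflect_shift by metis
qed

text \<open>With \<alpha> = 3 and \<lambda> = 13, the first power misses the odd integer 3 by 6/13,
  which exceeds 1/3. The powers up to the third are examined directly.\<close>

lemma Delta_5:
  assumes l: "l \<in> {tri_lambda 4 1 + 2, tri_lambda 4 1 - 2}"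
  shows "Delta 4 1 1 l = (6 / real_of_int (tri_lambda 4 1), enat 3)"
proof -
  have L: "tri_lambda 4 1 = 13" and A: "tri_alpha 4 1 = 3"
    by (simp_all add: tri_lambda_def tri_alpha_def)
  have mt: "multiple_t 4 1 l s = of_int (l ^ s * 3) / of_int 13" for s
    unfolding multiple_t_def L A by simp
  have l: "l = 15 \<or> l = 11" using l unfolding L by auto
  have least: "\<not> near_odd (multiple_t 4 1 l r)" if "r < 3" for r
  proof -
    have "r = 0 \<or> r = 1 \<or> r = 2" using that by auto
    \<comment> \<open>The witnesses are the nearest even integers: for \<open>r\<close> = 0, 1, 2
      the numerator differs from \<open>c * 13\<close> by 3, 7, 1 in absolute value.\<close>
    then obtain c :: int where "even c" "3 * \<bar>l ^ r * 3 - c * 13\<bar> \<le> 2 * 13"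
    proof (elim disjE)
      assume "r = 0" thus ?thesis using that[of 0] by simp
    next
      assume "r = 1" thus ?thesis using that[of "if l = 15 then 4 else 2"] l by auto
    next
      assume "r = 2" thus ?thesis using that[of "if l = 15 then 52 else 28"] l by auto
    qed
    thus ?thesis unfolding mt by (intro not_near_odd_divideI) auto
  qed
  \<comment> \<open>Nearest odd integers: 3 * 15^3 = 13 * 779 - 2 and 3 * 11^3 = 13 * 307 +
    2.\<close>
  define c :: int where "c = (if l = 15 then 779 else 307)"
  have dist: "3 * \<bar>multiple_t 4 1 l 3 - of_int c\<bar> = 6 / 13"
    "\<bar>multiple_t 4 1 l 3 - of_int c\<bar> < 1 / 3"
    unfolding mt using l by (auto simp: c_def)
  have "odd c" by (simp add: c_def)
  from Delta_eqI[OF this dist(2) least] show ?thesis unfolding dist(1) L by simp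
qed

text \<open>Since \<alpha> \<ge> 5, the factor \<alpha> + 1 is at least 6 and 6 \<alpha> <
  \<lambda>. Thus the deviation 2 \<alpha> / \<lambda> from \<alpha> at the first power is below
  1/3, and only exponent 0 remains to be excluded.\<close>

lemma Delta_odd:
  assumes d: "d \<ge> 7" "odd d"
    and l: "l \<in> {tri_lambda (d - 1) 1 + 2, tri_lambda (d - 1) 1 - 2}"
  shows "Delta (d - 1) 1 1 l =
    (6 * real_of_int (tri_alpha (d - 1) 1) / real_of_int (tri_lambda (d - 1) 1), enat 1)"
proof -
  define A L where AL: "A = tri_alpha (d - 1) 1" "L = tri_lambda (d - 1) 1"
  have d1: "d \<ge> 1" using d by simp
  have A: "A \<ge> 5" "odd A" using d by (auto simp: AL(1)[unfolded tri_alpha_d[OF d1]])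
  have L_eq: "L = A * (A + 1) + 1"
    unfolding AL tri_lambda_d_factor[OF d1] tri_alpha_d[OF d1] by simp
  have "A * 6 \<le> A * (A + 1)" using A by (intro mult_left_mono) auto
  hence L: "6 * A < L" "L > 0" using L_eq A by auto
  have "multiple_t (d - 1) 1 l 1 - of_int A = 2 * of_int A / of_int L \<or>
      multiple_t (d - 1) 1 l 1 - of_int A = - (2 * of_int A / of_int L)"
    using l L(2) unfolding multiple_t_def AL[symmetric] by (auto simp: field_simps)
  moreover have "2 * real_of_int A / of_int L \<ge> 0" using A L by simp
  ultimately have "\<bar>multiple_t (d - 1) 1 l 1 - of_int A\<bar> = 2 * of_int A / of_int L"
    by linarith
  hence dist: "3 * \<bar>multiple_t (d - 1) 1 l 1 - of_int A\<bar> = 6 * of_int A / of_int L"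
    by simp
  have "Delta (d - 1) 1 1 l = (3 * \<bar>multiple_t (d - 1) 1 l 1 - of_int A\<bar>, enat 1)"
  proof (rule Delta_eqI[OF A(2)])
    have "2 * real_of_int A / of_int L < 1 / 3"
      using L by (simp add: field_simps flip: of_int_less_iff)
    thus "\<bar>multiple_t (d - 1) 1 l 1 - of_int A\<bar> < 1 / 3" using dist by simp
    show "\<not> near_odd (multiple_t (d - 1) 1 l r)" if "r < 1" for r
      using first_term_not_near_odd[of d l] that d by simp
  qed
  thus ?thesis unfolding dist unfolding AL .
qed

theorem corollary4p7:
  shows "(\<forall>a1 a2 d :: nat.
            a2 < a1 \<and> d = a1 + a2 \<and> d \<ge> 4 \<and>
            irreducible (sym_trinomial a1 a2 :: 'k::field poly3) \<longrightarrow>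
            (\<forall>(l :: int) (s :: nat).
               l \<ge> 1 \<and> coprime l (2 * tri_lambda a1 a2) \<and>
               3 * real_of_int l ^ s / 4
                 \<le> real_of_int (tri_lambda a1 a2) / real_of_int (tri_alpha a1 a2) \<and>
               real_of_int (tri_lambda a1 a2) / real_of_int (tri_alpha a1 a2)
                 < 3 * real_of_int l ^ s / 2 \<longrightarrow>
               Delta a1 a2 1 l =
                 (3 * \<bar>real_of_int l ^ s * real_of_int (tri_alpha a1 a2)
                        / real_of_int (tri_lambda a1 a2) - 1\<bar>, enat s)))
       \<and> (\<forall>d :: nat.
            d \<ge> 3 \<and> irreducible (sym_trinomial (d - 1) 1 :: 'k::field poly3) \<longrightarrow>
            (let a = tri_alpha (d - 1) 1; L = tri_lambda (d - 1) 1 in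
               a = int d - 2 \<and> L = (int d)\<^sup>2 - 3 * int d + 3 \<and> tri_lambda_h (d - 1) 1 = L \<and>
               (d \<ge> 4 \<and> even d \<longrightarrow>
                  (\<exists>m::nat. m \<ge> 2 \<and> 3 * 2 ^ (m - 2) \<le> d - 1 \<and> d - 1 < 3 * 2 ^ (m - 1)) \<and>
                  (\<forall>m::nat. m \<ge> 2 \<and> 3 * 2 ^ (m - 2) \<le> d - 1 \<and> d - 1 < 3 * 2 ^ (m - 1) \<longrightarrow>
                     (\<forall>l \<in> {L + 2, L - 2}.
                        Delta (d - 1) 1 1 l =
                          (3 * \<bar>1 - 2 ^ m * real_of_int a / real_of_int L\<bar>, enat m)))) \<and>
               (odd d \<longrightarrow>
                  (\<forall>l \<in> {L + 2, L - 2}.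
                     (d = 3 \<longrightarrow> Delta (d - 1) 1 1 l = (1, \<infinity>)) \<and>
                     (d = 5 \<longrightarrow> Delta (d - 1) 1 1 l = (6 / real_of_int L, enat 3)) \<and>
                     (d \<ge> 7 \<longrightarrow> Delta (d - 1) 1 1 l =
                                   (6 * real_of_int a / real_of_int L, enat 1))))))"
proof (intro conjI allI impI, goal_cases)
  case (1 a1 a2 d l s)
  thus ?case using Delta_between[of a2 a1 l s] by (simp add: multiple_t_def)
next
  case (2 d)
  hence d: "d \<ge> 1" "d \<ge> 3" by auto
  show ?case
    unfolding Let_def
  proof (intro conjI allI impI ballI, goal_cases)
    case 1 show ?case by (rule tri_alpha_d[OF d(1)])
  next
    case 2 show ?case by (rule tri_lambda_d[OF d(1)])
  next
    case 3 show ?case by (rule tri_lambda_h_d[OF d(1)])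
  next
    case 4 thus ?case using binary_scale_exists[of "d - 1"] by auto
  next
    case (5 m l) thus ?case using Delta_even[of d m l] by blast
  next
    case (6 l) thus ?case using Delta_3[of l] by simp
  next
    case (7 l) thus ?case using Delta_5[of l] by simp
  next
    case (8 l) thus ?case using Delta_odd[of d l] by blast
  qed
qed

end
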